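(* Let $n\in\mathbb N$, let $U,V\subset\mathbb R^n$ be domains, $(s,t)\subset\mathbb R$ an open interval, $\underline a=\sum_{i=1}^n a_ie_i\in C^1(U,V)$ a diffeomorphism with real-valued components, and $a:(s,t)\times U\to(s,t)\times V$, $a(x)=x_0+\underline a(\underline x)$. Suppose $(s,t)\times V$ is an axially symmetric s-domain and $f\in C^1((s,t)\times U,\mathbb R_{0,n})$ satisfies $f\circ a^{-1}\in\mathcal{SM}((s,t)\times V)$. Then $\mathcal H_a(f)=0$ on $(s,t)\times U$. Moreover, for every $I=I_1\in\mathbb S$, let $I_2,\dots,I_n$ be a completion to a basis of $\mathbb R_{0,n}$ satisfying the defining relations $I_rI_s+I_sI_r=-2\delta_{rs}$. Then there exist $2^{n-1}$ holomorphic functions $F_A:((s,t)\times V)\cap\mathbb C_I\to\mathbb C_I$, indexed by the subsets $A\subset\{2,\dots,n\}$, such that for every $x\in a^{-1}\big(((s,t)\times V)\cap\mathbb C_I\big)$, $$f(x)=\sum_{A\subset\{2,\dots,n\}}F_A(a(x))\,I_A,$$ where $I_A=I_{i_1}\cdots I_{i_s}$ for $A=\{i_1<\dots<i_s\}$ and $I_\emptyset=1$.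
   Context: $\mathbb R_{0,n}$ is the real Clifford algebra generated by $e_1,\dots,e_n$ with $e_ie_j+e_je_i=-2\delta_{ij}$. A point of $\mathbb R^{n+1}$ is identified with the paravector $x=x_0+\underline x$, $\underline x=\sum_{j=1}^n x_je_j$. $\mathbb S=\{\underline x:\ x_1^2+\dots+x_n^2=1\}$; for $I\in\mathbb S$, $\mathbb C_I=\mathbb R+I\mathbb R\subset\mathbb R^{n+1}$, a field isomorphic to $\mathbb C$. "Completion to a basis of $\mathbb R_{0,n}$" means that $I_1,\dots,I_n$ generate $\mathbb R_{0,n}$, i.e. the $2^n$ ordered products of the $I_r$ form a real vector space basis of $\mathbb R_{0,n}$. "Diffeomorphism" means a $C^1$ bijection with $C^1$ inverse; $a^{-1}(y)=y_0+\sum_j(a^{-1})_j(\underline y)e_j$, with $(a^{-1})_j$ the $j$-th component of $(\underline a)^{-1}$. Operator: $$\mathcal H_a(f)(x)=\underline a(\underline x)\frac{\partial f}{\partial x_0}(x)-\sum_{i=1}^n\Big(\sum_{j=1}^n a_j(\underline x)\Big(\frac{\partial(a^{-1})_i}{\partial y_j}\circ a\Big)(x)\Big)\frac{\partial f}{\partial x_i}(x).$$ A domain $W\subset\mathbb R^{n+1}$ is an s-domain if $W\cap\mathbb R\neq\emptyset$ and $W\cap\mathbb C_I$ is a domain in $\mathbb C_I$ for all $I\in\mathbb S$; $W$ is axially symmetric if $u+Iv\in W$ implies $u+Jv\in W$ for all $J\in\mathbb S$. $\mathcal{SM}(W)$ is the set of real differentiable $h:W\to\mathbb R_{0,n}$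 with $\big(\frac{\partial}{\partial u}+I\frac{\partial}{\partial v}\big)h|_{W\cap\mathbb C_I}(u+Iv)=0$ on $W\cap\mathbb C_I$ for every $I\in\mathbb S$. *)

theory Defs
  imports "HOL-Analysis.Analysis"
begin

section \<open>The real Clifford algebra\<close>

text \<open>The dimension \<open>n\<close> is the cardinality of the index type \<open>'n\<close>; its linear order lists
  the generators.  An element is given by its coordinates with respect to the basis of ordered
  products \<open>e\<^sub>A = e\<^bsub>i1\<^esub> \<cdots> e\<^bsub>ik\<^esub>\<close>, \<open>A = {i1 < \<dots> < ik}\<close>.\<close>

typedef ('n::"{finite,linorder}") clifford = "UNIV :: (real ^ ('n set)) set"
  morphisms coords of_coords
  by simp

setup_lifting type_definition_clifford

text \<open>\<open>e\<^sub>A e\<^sub>B = (-1)\<^sup>m e\<^bsub>sym_diff A B\<^esub>\<close>, where \<open>m\<close> counts the pairs \<open>(i, j)\<close> in \<open>A \<times> B\<close>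
  with \<open>j < i\<close> (a transposition) or \<open>j = i\<close> (a factor \<open>e\<^sub>i\<^sup>2 = -1\<close>).\<close>

definition clifford_sign :: "'n::{finite,linorder} set \<Rightarrow> 'n set \<Rightarrow> real" where
  "clifford_sign A B = (\<Prod>i\<in>A. \<Prod>j\<in>B. if j \<le> i then -1 else 1)"

lemma prod_sym_diff:
  fixes g :: "'a::finite \<Rightarrow> real"
  assumes "\<And>i. g i * g i = 1"
  shows "prod g (sym_diff A B) = prod g A * prod g B"
proof -
  have A: "prod g A = prod g (A - B) * prod g (A \<inter> B)"
    by (subst prod.union_disjoint[symmetric]) (auto intro: prod.cong)
  have B: "prod g B = prod g (B - A) * prod g (A \<inter> B)"
    by (subst prod.union_disjoint[symmetric]) (auto intro: prod.cong)
  have "prod g (A \<inter> B) * prod g (A \<inter> B) = 1"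
    by (simp add: prod.distrib[symmetric] assms)
  then have "prod g A * prod g B = prod g (A - B) * prod g (B - A)"
    unfolding A B by (simp add: algebra_simps)
  also have "\<dots> = prod g (sym_diff A B)"
    by (subst prod.union_disjoint) auto
  finally show ?thesis by simp
qed

lemma clifford_sign_sym_diff_left:
  "clifford_sign (sym_diff A B) C = clifford_sign A C * clifford_sign B C"
  unfolding clifford_sign_def
  by (rule prod_sym_diff) (simp add: prod.distrib[symmetric], rule prod.neutral, simp)

lemma clifford_sign_sym_diff_right:
  "clifford_sign C (sym_diff A B) = clifford_sign C A * clifford_sign C B"
proof -
  have "(\<Prod>j\<in>sym_diff A B. if j \<le> i then -1 else 1) =
      (\<Prod>j\<in>A. if j \<le> i then -1 else 1) * (\<Prod>j\<in>B. if j \<le> i then -1 else (1::real))" for i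
    by (rule prod_sym_diff) simp
  then show ?thesis
    unfolding clifford_sign_def by (simp add: prod.distrib)
qed

lemma clifford_sign_square: "clifford_sign A B * clifford_sign A B = 1"
  unfolding clifford_sign_def
  by (simp add: prod.distrib[symmetric], intro prod.neutral ballI, simp)

lemma clifford_sign_empty [simp]: "clifford_sign {} B = 1" "clifford_sign A {} = 1"
  by (simp_all add: clifford_sign_def)

lemma clifford_sign_singleton: "clifford_sign {i} {j} = (if j \<le> i then -1 else 1)"
  by (simp add: clifford_sign_def)

lemma sym_diff_cancel: "sym_diff A (sym_diff A B) = B"
  by blast

lemma bij_sym_diff: "bij (\<lambda>B. sym_diff A B)"
  by (rule involuntory_imp_bij) (rule sym_diff_cancel)

instantiation clifford :: ("{finite,linorder}") real_vector
begin

lift_definition zero_clifford :: "'a clifford" is 0 .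
lift_definition plus_clifford :: "'a clifford \<Rightarrow> 'a clifford \<Rightarrow> 'a clifford" is "(+)" .
lift_definition minus_clifford :: "'a clifford \<Rightarrow> 'a clifford \<Rightarrow> 'a clifford" is "(-)" .
lift_definition uminus_clifford :: "'a clifford \<Rightarrow> 'a clifford" is uminus .
lift_definition scaleR_clifford :: "real \<Rightarrow> 'a clifford \<Rightarrow> 'a clifford" is "(*\<^sub>R)" .

instance
proof
  fix a b :: real and x y z :: "'a clifford"
  show "x + y + z = x + (y + z)" by transfer (simp add: algebra_simps)
  show "x + y = y + x" by transfer (simp add: algebra_simps)
  show "0 + x = x" by transfer simp
  show "- x + x = 0" by transfer simp
  show "x - y = x + - y" by transfer simp
  show "a *\<^sub>R (x + y) = a *\<^sub>R x + a *\<^sub>R y" by transfer (simp add: algebra_simps)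
  show "(a + b) *\<^sub>R x = a *\<^sub>R x + b *\<^sub>R x" by transfer (simp add: algebra_simps)
  show "a *\<^sub>R b *\<^sub>R x = (a * b) *\<^sub>R x" by transfer simp
  show "1 *\<^sub>R x = x" by transfer simp
qed

end

instantiation clifford :: ("{finite,linorder}") euclidean_space
begin

lift_definition inner_clifford :: "'a clifford \<Rightarrow> 'a clifford \<Rightarrow> real" is "(\<bullet>)" .
lift_definition norm_clifford :: "'a clifford \<Rightarrow> real" is norm .

definition "sgn_clifford (x::'a clifford) = x /\<^sub>R norm x"
definition "dist_clifford (x::'a clifford) y = norm (x - y)"
definition "(uniformity :: ('a clifford \<times> 'a clifford) filter) =
  (INF e\<in>{0<..}. principal {(x, y). dist x y < e})"
definition "open_clifford (S :: 'a clifford set) \<longleftrightarrow>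
  (\<forall>x\<in>S. \<forall>\<^sub>F (x', y) in uniformity. x' = x \<longrightarrow> y \<in> S)"
definition "(Basis :: 'a clifford set) = of_coords ` Basis"

instance
proof
  fix a :: real and x y z :: "'a clifford" and S :: "'a clifford set"
  show "dist x y = norm (x - y)" by (rule dist_clifford_def)
  show "sgn x = x /\<^sub>R norm x" by (rule sgn_clifford_def)
  show "(uniformity :: ('a clifford \<times> 'a clifford) filter) =
    (INF e\<in>{0<..}. principal {(x, y). dist x y < e})" by (rule uniformity_clifford_def)
  show "open S \<longleftrightarrow> (\<forall>x\<in>S. \<forall>\<^sub>F (x', y) in uniformity. x' = x \<longrightarrow> y \<in> S)"
    by (rule open_clifford_def)
  show "x \<bullet> y = y \<bullet> x" by transfer (rule inner_commute)
  show "(x + y) \<bullet> z = x \<bullet> z + y \<bullet> z" by transfer (rule inner_add_left)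
  show "a *\<^sub>R x \<bullet> y = a * (x \<bullet> y)" by transfer simp
  show "0 \<le> x \<bullet> x" by transfer simp
  show "x \<bullet> x = 0 \<longleftrightarrow> x = 0" by transfer simp
  show "norm x = sqrt (x \<bullet> x)" by transfer (rule norm_eq_sqrt_inner)
  show "(Basis :: 'a clifford set) \<noteq> {}" by (simp add: Basis_clifford_def)
  show "finite (Basis :: 'a clifford set)" by (simp add: Basis_clifford_def)
  show "x \<bullet> y = (if x = y then 1 else 0)" if "x \<in> Basis" "y \<in> Basis"
    using that unfolding Basis_clifford_def
    by (auto simp: inner_clifford.rep_eq of_coords_inverse of_coords_inject inner_Basis)
  show "(\<forall>y\<in>Basis. x \<bullet> y = 0) \<longleftrightarrow> x = 0"
    unfolding Basis_clifford_def
    by (simp add: inner_clifford.rep_eq of_coords_inverse euclidean_all_zero_iff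
        zero_clifford.rep_eq coords_inject[symmetric])
qed

end

instantiation clifford :: ("{finite,linorder}") real_algebra_1
begin

lift_definition one_clifford :: "'a clifford" is "axis {} 1" .

text \<open>The summand below comes from \<open>e\<^sub>A e\<^sub>B\<close> with \<open>B = sym_diff A C\<close>, that is
  \<open>sym_diff A B = C\<close>.\<close>

lift_definition times_clifford :: "'a clifford \<Rightarrow> 'a clifford \<Rightarrow> 'a clifford" is
  "\<lambda>x y. \<chi> C. \<Sum>A\<in>UNIV. clifford_sign A (sym_diff A C) * x $ A * y $ (sym_diff A C)" .

instance
proof
  fix a :: real and x y z :: "'a clifford"
  show "x * y * z = x * (y * z)"
  proof (transfer, subst vec_eq_iff, intro allI, simp only: vec_lambda_beta)
    fix x y z :: "real ^ ('a set)" and D :: "'a set"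
    let ?s = "clifford_sign :: 'a set \<Rightarrow> 'a set \<Rightarrow> real"
    have sgn: "?s A (sym_diff A C) * ?s C (sym_diff C D) =
        ?s (sym_diff A C) (sym_diff C D) * ?s A (sym_diff A D)" for A C
      using clifford_sign_square[of A D]
      by (simp add: clifford_sign_sym_diff_left clifford_sign_sym_diff_right algebra_simps)
    have reindex: "(\<Sum>B\<in>UNIV. ?s B (sym_diff B (sym_diff A D)) * y $ B
          * z $ (sym_diff B (sym_diff A D))) =
        (\<Sum>C\<in>UNIV. ?s (sym_diff A C) (sym_diff C D) * y $ (sym_diff A C) * z $ (sym_diff C D))"
      for A
    proof -
      have *: "sym_diff (sym_diff A C) (sym_diff A D) = sym_diff C D" for C by blast
      show ?thesis
        by (subst sum.reindex_bij_betw[OF bij_sym_diff[of A], symmetric]) (simp only: *)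
    qed
    have "(\<Sum>C\<in>UNIV. ?s C (sym_diff C D) *
          (\<Sum>A\<in>UNIV. ?s A (sym_diff A C) * x $ A * y $ (sym_diff A C)) * z $ (sym_diff C D)) =
        (\<Sum>C\<in>UNIV. \<Sum>A\<in>UNIV. (?s A (sym_diff A C) * ?s C (sym_diff C D))
          * (x $ A * y $ (sym_diff A C) * z $ (sym_diff C D)))"
      by (simp only: sum_distrib_left sum_distrib_right mult_ac)
    also have "\<dots> = (\<Sum>A\<in>UNIV. \<Sum>C\<in>UNIV. (?s A (sym_diff A C) * ?s C (sym_diff C D))
          * (x $ A * y $ (sym_diff A C) * z $ (sym_diff C D)))"
      by (rule sum.swap)
    also have "\<dots> = (\<Sum>A\<in>UNIV. ?s A (sym_diff A D) * x $ A *
        (\<Sum>C\<in>UNIV. ?s (sym_diff A C) (sym_diff C D) * y $ (sym_diff A C) * z $ (sym_diff C D)))"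
      by (simp only: sgn) (simp only: sum_distrib_left mult_ac)
    also have "\<dots> = (\<Sum>A\<in>UNIV. ?s A (sym_diff A D) * x $ A *
        (\<Sum>B\<in>UNIV. ?s B (sym_diff B (sym_diff A D)) * y $ B * z $ (sym_diff B (sym_diff A D))))"
      by (simp only: reindex)
    finally show "(\<Sum>C\<in>UNIV. ?s C (sym_diff C D) *
          (\<Sum>A\<in>UNIV. ?s A (sym_diff A C) * x $ A * y $ (sym_diff A C)) * z $ (sym_diff C D)) =
        (\<Sum>A\<in>UNIV. ?s A (sym_diff A D) * x $ A *
        (\<Sum>B\<in>UNIV. ?s B (sym_diff B (sym_diff A D)) * y $ B * z $ (sym_diff B (sym_diff A D))))" .
  qed
  show "(x + y) * z = x * z + y * z"
    by transfer (simp add: vec_eq_iff algebra_simps sum.distrib)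
  show "x * (y + z) = x * y + x * z"
    by transfer (simp add: vec_eq_iff algebra_simps sum.distrib)
  show "a *\<^sub>R x * y = a *\<^sub>R (x * y)"
    by transfer (simp add: vec_eq_iff sum_distrib_left mult_ac)
  show "x * a *\<^sub>R y = a *\<^sub>R (x * y)"
    by transfer (simp add: vec_eq_iff sum_distrib_left mult_ac)
  show "1 * x = x"
  proof (transfer, subst vec_eq_iff, intro allI, simp only: vec_lambda_beta)
    fix x :: "real ^ ('a set)" and C :: "'a set"
    have "(\<Sum>A\<in>UNIV. clifford_sign A (sym_diff A C) * axis {} 1 $ A * x $ (sym_diff A C)) =
      (\<Sum>A\<in>UNIV. if A = ({} :: 'a set) then x $ C else 0)"
      by (rule sum.cong) (auto simp: axis_def)
    then show "(\<Sum>A\<in>UNIV. clifford_sign A (sym_diff A C) * axis {} 1 $ A * x $ (sym_diff A C)) =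
      x $ C" by simp
  qed
  show "x * 1 = x"
  proof (transfer, subst vec_eq_iff, intro allI, simp only: vec_lambda_beta)
    fix x :: "real ^ ('a set)" and C :: "'a set"
    have "(\<Sum>A\<in>UNIV. clifford_sign A (sym_diff A C) * x $ A * axis {} 1 $ (sym_diff A C)) =
      (\<Sum>A\<in>UNIV. if A = C then x $ C else 0)"
      by (rule sum.cong) (auto simp: axis_def)
    then show "(\<Sum>A\<in>UNIV. clifford_sign A (sym_diff A C) * x $ A * axis {} 1 $ (sym_diff A C)) =
      x $ C" by simp
  qed
  show "(0 :: 'a clifford) \<noteq> 1"
    by transfer (simp add: axis_eq_0_iff eq_commute[of 0])
qed

end

definition gen :: "'n::{finite,linorder} \<Rightarrow> 'n clifford" where
  "gen i = of_coords (axis {i} 1)"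

definition ordered_prod :: "('n::{finite,linorder} \<Rightarrow> 'n clifford) \<Rightarrow> 'n set \<Rightarrow> 'n clifford" where
  "ordered_prod b A = prod_list (map b (sorted_list_of_set A))"

text \<open>The following two facts justify the encoding: the generators satisfy the defining
  relations, and the coordinates are those with respect to their ordered products.\<close>

lemma of_coords_axis_mult:
  "of_coords (axis A 1) * of_coords (axis B 1) =
    clifford_sign A B *\<^sub>R of_coords (axis (sym_diff A B) 1)"
proof -
  have "(\<Sum>A'\<in>UNIV. clifford_sign A' (sym_diff A' C) * axis A 1 $ A'
          * axis B 1 $ (sym_diff A' C)) =
      clifford_sign A B * axis (sym_diff A B) 1 $ C" for C
  proof -
    have *: "sym_diff A C = B \<longleftrightarrow> C = sym_diff A B" by blast
    have "(\<Sum>A'\<in>UNIV. clifford_sign A' (sym_diff A' C) * axis A 1 $ A'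
          * axis B 1 $ (sym_diff A' C)) =
        (\<Sum>A'\<in>UNIV. if A' = A then clifford_sign A (sym_diff A C)
          * axis B 1 $ (sym_diff A C) else 0)"
      by (rule sum.cong) (auto simp: axis_def)
    also have "\<dots> = clifford_sign A (sym_diff A C) * axis B 1 $ (sym_diff A C)"
      by simp
    also have "\<dots> = clifford_sign A B * axis (sym_diff A B) 1 $ C"
    proof (cases "C = sym_diff A B")
      case True
      then have "sym_diff A C = B" by blast
      then show ?thesis using True by (simp only: axis_nth)
    next
      case False
      then have "sym_diff A C \<noteq> B" by blast
      then show ?thesis using False by (simp only: axis_def vec_lambda_beta if_False mult_zero_right)
    qed
    finally show ?thesis .
  qed
  then have "coords (of_coords (axis A 1) * of_coords (axis B 1)) =
      coords (clifford_sign A B *\<^sub>R of_coords (axis (sym_diff A B) 1))"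
    by (simp only: times_clifford.rep_eq scaleR_clifford.rep_eq of_coords_inverse UNIV_I
        vec_eq_iff vec_lambda_beta vector_scaleR_component real_scaleR_def simp_thms)
  then show ?thesis by (simp only: coords_inject)
qed

lemma gen_relations: "gen r * gen s + gen s * gen r = (if r = s then -2 else 0)"
proof -
  have one: "of_coords (axis {} 1) = (1 :: 'a clifford)"
    by (simp add: one_clifford_def)
  show ?thesis
  proof (cases "r = s")
    case True
    then show ?thesis by (simp add: gen_def of_coords_axis_mult clifford_sign_singleton one)
  next
    case False
    then have "{r} - {s} \<union> ({s} - {r}) = {s} - {r} \<union> ({r} - {s})" by blast
    with False show ?thesis
      by (cases "r < s") (auto simp: gen_def of_coords_axis_mult clifford_sign_singleton)
  qed
qed

lemma ordered_prod_gen: "ordered_prod gen A = of_coords (axis A 1)"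
proof -
  have "finite A" by simp
  then show ?thesis
  proof (induction A rule: finite_remove_induct)
    case empty
    then show ?case by (simp add: ordered_prod_def one_clifford_def)
  next
    case (remove A)
    let ?m = "Min A"
    let ?A = "A - {?m}"
    have m: "?m \<in> A" using remove by simp
    have "sorted_list_of_set A = ?m # sorted_list_of_set ?A"
      using remove by (intro sorted_list_of_set_nonempty) auto
    then have "ordered_prod gen A = gen ?m * ordered_prod gen ?A"
      by (simp add: ordered_prod_def)
    also have "\<dots> = of_coords (axis {?m} 1) * of_coords (axis ?A 1)"
      using remove.IH[OF m] by (simp only: gen_def[of ?m])
    also have "\<dots> = clifford_sign {?m} ?A *\<^sub>R of_coords (axis (sym_diff {?m} ?A) 1)"
      by (rule of_coords_axis_mult)
    also have "clifford_sign {?m} ?A = 1"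
    proof -
      have "\<not> j \<le> ?m" if "j \<in> ?A" for j
        using that Min_le[of A j] by (auto dest: order.antisym)
      then show ?thesis by (simp add: clifford_sign_def)
    qed
    also have "sym_diff {?m} ?A = A" using m by blast
    finally show ?case by simp
  qed
qed


section \<open>Paravectors and slices\<close>

text \<open>Points of \<open>\<real>\<^bsup>n+1\<^esup>\<close> are pairs \<open>(x\<^sub>0, x)\<close> with \<open>x\<close> in \<open>\<real>\<^sup>n\<close>; the identification with
  elements of the Clifford algebra is made explicit by \<open>vec_to_clifford\<close> and \<open>paravector\<close>.\<close>

type_synonym 'n point = "real \<times> (real, 'n) vec"

definition vec_to_clifford :: "(real, 'n::{finite,linorder}) vec \<Rightarrow> 'n clifford" where
  "vec_to_clifford x = (\<Sum>j\<in>UNIV. (x $ j) *\<^sub>R gen j)"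

definition paravector :: "'n::{finite,linorder} point \<Rightarrow> 'n clifford" where
  "paravector x = of_real (fst x) + vec_to_clifford (snd x)"

definition unit_vectors :: "(real ^ 'n) set" (\<open>\<S>\<close>) where
  "\<S> = {x. (\<Sum>j\<in>UNIV. (x $ j)\<^sup>2) = 1}"

text \<open>For a unit vector \<open>I\<close>, the map \<open>u + \<i> v \<mapsto> u + I v\<close> is the isomorphism from the complex
  numbers onto the slice determined by \<open>I\<close>.\<close>

definition slice_iso :: "real ^ 'n \<Rightarrow> complex \<Rightarrow> 'n point" where
  "slice_iso I z = (Re z, Im z *\<^sub>R I)"

definition slice :: "real ^ 'n \<Rightarrow> 'n point set" where
  "slice I = range (slice_iso I)"

definition holomorphic_slice_on ::
  "real ^ 'n \<Rightarrow> ('n point \<Rightarrow> 'n point) \<Rightarrow> 'n point set \<Rightarrow> bool" where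
  "holomorphic_slice_on I F D \<longleftrightarrow> F ` D \<subseteq> slice I \<and>
    (inv (slice_iso I) \<circ> F \<circ> slice_iso I) holomorphic_on (slice_iso I -` D)"

definition domain_in :: "'a::topological_space set \<Rightarrow> 'a set \<Rightarrow> bool" where
  "domain_in X D \<longleftrightarrow> openin (top_of_set X) D \<and> connected D \<and> D \<noteq> {}"

definition s_domain :: "'n::finite point set \<Rightarrow> bool" where
  "s_domain W \<longleftrightarrow> domain_in UNIV W \<and> W \<inter> (UNIV \<times> {0}) \<noteq> {} \<and>
    (\<forall>I\<in>\<S>. domain_in (slice I) (W \<inter> slice I))"

definition axially_symmetric :: "'n::finite point set \<Rightarrow> bool" where
  "axially_symmetric W \<longleftrightarrow>
    (\<forall>u v. \<forall>I\<in>\<S>. (u, v *\<^sub>R I) \<in> W \<longrightarrow> (\<forall>J\<in>\<S>. (u, v *\<^sub>R J) \<in> W))"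


section \<open>Differentiability, slice monogenic functions and the operator\<close>

definition C1_on :: "'a::real_normed_vector set \<Rightarrow> ('a \<Rightarrow> 'b::real_normed_vector) \<Rightarrow> bool" where
  "C1_on S f \<longleftrightarrow> (\<exists>f' :: 'a \<Rightarrow> 'a \<Rightarrow>\<^sub>L 'b.
    (\<forall>x\<in>S. (f has_derivative blinfun_apply (f' x)) (at x)) \<and> continuous_on S f')"

definition C1_diffeomorphism ::
  "'a::real_normed_vector set \<Rightarrow> 'b::real_normed_vector set \<Rightarrow> ('a \<Rightarrow> 'b) \<Rightarrow> bool" where
  "C1_diffeomorphism U V g \<longleftrightarrow> bij_betw g U V \<and> C1_on U g \<and> C1_on V (inv_into U g)"

text \<open>For a coordinate vector \<open>v\<close> this is the partial derivative.\<close>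

definition partial :: "'a::real_normed_vector \<Rightarrow> ('a \<Rightarrow> 'b::real_normed_vector) \<Rightarrow> 'a \<Rightarrow> 'b" where
  "partial v f x = vector_derivative (\<lambda>t. f (x + t *\<^sub>R v)) (at 0)"

definition slice_monogenic ::
  "'n::{finite,linorder} point set \<Rightarrow> ('n point \<Rightarrow> 'n clifford) set" where
  "slice_monogenic W = {h. h differentiable_on W \<and>
    (\<forall>I\<in>\<S>. \<forall>u v. (u, v *\<^sub>R I) \<in> W \<longrightarrow>
      vector_derivative (\<lambda>u'. h (u', v *\<^sub>R I)) (at u) +
      vec_to_clifford I * vector_derivative (\<lambda>v'. h (u, v' *\<^sub>R I)) (at v) = 0)}"

text \<open>Here \<open>a\<close> is the map on vector parts, so the map \<open>x\<^sub>0 + a x\<close> on \<open>\<real>\<^bsup>n+1\<^esup>\<close> is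
  \<open>map_prod id a\<close>; the set \<open>U\<close> enters through the inverse of \<open>a : U \<rightarrow> V\<close>.\<close>

definition H_op ::
  "(real, 'n::{finite,linorder}) vec set \<Rightarrow> ((real, 'n) vec \<Rightarrow> (real, 'n) vec) \<Rightarrow>
    ('n point \<Rightarrow> 'n clifford) \<Rightarrow> 'n point \<Rightarrow> 'n clifford" where
  "H_op U a f x =
    vec_to_clifford (a (snd x)) * partial (1, 0) f x -
    (\<Sum>i\<in>UNIV. (\<Sum>j\<in>UNIV. a (snd x) $ j *
        partial (axis j 1) (\<lambda>y. inv_into U a y $ i) (a (snd x))) *\<^sub>R
      partial (0, axis i 1) f x)"

text \<open>The \<open>b r\<close> may be arbitrary elements of the algebra, not only vectors.\<close>

definition clifford_generators :: "('n::{finite,linorder} \<Rightarrow> 'n clifford) \<Rightarrow> bool" where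
  "clifford_generators b \<longleftrightarrow>
    (\<forall>r s. b r * b s + b s * b r = (if r = s then -2 else 0)) \<and>
    inj (ordered_prod b) \<and> independent (range (ordered_prod b)) \<and>
    span (range (ordered_prod b)) = UNIV"

end

theory Submission
  imports Defs
begin

text \<open>Put \<open>h = f \<circ> a\<^sup>-\<^sup>1\<close>.  Multiplying the slice Cauchy--Riemann equation for \<open>h\<close> at \<open>u + I v\<close>
  from the left by \<open>v I\<close> gives \<open>y \<partial>\<^sub>0 h - \<Sum>\<^sub>j y\<^sub>j \<partial>\<^sub>j h = 0\<close> with \<open>y = v I\<close>; the chain rule turns
  this into the vanishing of the operator on \<open>f\<close>.  For the splitting, left multiplication by
  \<open>I = I\<^sub>1\<close> maps \<open>I\<^sub>A\<close> to \<open>I\<^bsub>{1} \<union> A\<^esub>\<close> and \<open>I\<^bsub>{1} \<union> A\<^esub>\<close> to \<open>- I\<^sub>A\<close>, so the slice equation decouples into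
  the Cauchy--Riemann equations for the pairs of coordinates at \<open>I\<^sub>A\<close> and \<open>I\<^bsub>{1} \<union> A\<^esub>\<close>.\<close>

section \<open>Vectors in the Clifford algebra and their squares\<close>

lemma vec_to_clifford_scaleR: "vec_to_clifford (c *\<^sub>R x) = c *\<^sub>R vec_to_clifford x"
  by (simp add: vec_to_clifford_def scaleR_sum_right)

text \<open>Adding the double sum to its transpose turns the products of generators into
  anticommutators, which vanish off the diagonal.\<close>

lemma vec_to_clifford_square:
  "vec_to_clifford x * vec_to_clifford x = - of_real (\<Sum>j\<in>UNIV. (x $ j)\<^sup>2)"
proof -
  let ?p = "\<lambda>i j. (x $ j * x $ i) *\<^sub>R (gen i * gen j)"
  have "vec_to_clifford x * vec_to_clifford x = (\<Sum>i\<in>UNIV. \<Sum>j\<in>UNIV. ?p i j)"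
    by (simp add: vec_to_clifford_def sum_product)
  moreover have "(\<Sum>i\<in>UNIV. \<Sum>j\<in>UNIV. ?p i j) = (\<Sum>i\<in>UNIV. \<Sum>j\<in>UNIV. ?p j i)"
    by (rule sum.swap)
  ultimately have "2 *\<^sub>R (vec_to_clifford x * vec_to_clifford x) =
      (\<Sum>i\<in>UNIV. \<Sum>j\<in>UNIV. ?p i j) + (\<Sum>i\<in>UNIV. \<Sum>j\<in>UNIV. ?p j i)"
    by (simp add: scaleR_2)
  also have "\<dots> = (\<Sum>i\<in>UNIV. \<Sum>j\<in>UNIV. (x $ i * x $ j) *\<^sub>R (gen i * gen j + gen j * gen i))"
    by (simp add: sum.distrib[symmetric] scaleR_add_right mult.commute)
  also have "\<dots> = (\<Sum>i\<in>UNIV. \<Sum>j\<in>UNIV. if i = j then (x $ i * x $ j) *\<^sub>R (- 2) else 0)"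
    by (intro sum.cong refl) (simp only: gen_relations, simp)
  also have "\<dots> = 2 *\<^sub>R - of_real (\<Sum>j\<in>UNIV. (x $ j)\<^sup>2)"
    by (simp add: power2_eq_square scaleR_conv_of_real mult_2 mult_2_right sum.distrib sum_negf
        sum_subtractf)
  finally show ?thesis
    by (simp only: scaleR_cancel_left) simp
qed

lemma vec_to_clifford_unit: "I \<in> \<S> \<Longrightarrow> vec_to_clifford I * vec_to_clifford I = -1"
  by (simp add: vec_to_clifford_square unit_vectors_def)

lemma vec_sum_square: "(\<Sum>j\<in>UNIV. (x $ j)\<^sup>2) = (norm x)\<^sup>2" for x :: "real ^ 'n"
  by (simp add: norm_vec_def L2_set_def sum_nonneg)

text \<open>Puts every point of the domain on some slice, so that the slice equation can be used
  everywhere.\<close>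

lemma scaled_unit_vector:
  fixes y :: "real ^ 'n"
  obtains I v where "I \<in> \<S>" "y = v *\<^sub>R I"
proof (cases "y = 0")
  case True
  show ?thesis
    \<comment> \<open>The zero vector lies on every slice; the index \<open>undefined\<close> is an
      arbitrary choice.\<close>
    by (rule that[of "axis undefined 1" 0])
      (simp_all add: True unit_vectors_def vec_sum_square norm_axis_1)
next
  case False
  show ?thesis
    by (rule that[of "sgn y" "norm y"])
      (use False in \<open>simp_all add: unit_vectors_def vec_sum_square norm_sgn sgn_div_norm\<close>)
qed

section \<open>The slice equation in terms of total derivatives, and the operator\<close>

lemma partial_eq:
  assumes "(f has_derivative f') (at x)"
  shows "partial v f x = f' v"
proof -
  have "((\<lambda>t. f (x + t *\<^sub>R v)) has_derivative (\<lambda>t. f' (t *\<^sub>R v))) (at 0)"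
    by (rule has_derivative_compose[of "\<lambda>t. x + t *\<^sub>R v"])
      (auto intro!: derivative_eq_intros assms)
  moreover have "(\<lambda>t. f' (t *\<^sub>R v)) = (\<lambda>t. t *\<^sub>R f' v)"
    using has_derivative_bounded_linear[OF assms]
    by (simp add: linear_simps)
  ultimately show ?thesis
    unfolding partial_def by (intro vector_derivative_at) (simp add: has_vector_derivative_def)
qed

lemma slice_monogenic_derivative:
  assumes "h \<in> slice_monogenic W" "I \<in> \<S>" "(u, v *\<^sub>R I) \<in> W"
    and h': "(h has_derivative h') (at (u, v *\<^sub>R I))"
  shows "h' (1, 0) + vec_to_clifford I * h' (0, I) = 0"
proof -
  interpret h': bounded_linear h' using h' by (rule has_derivative_bounded_linear)
  have "((\<lambda>u'. h (u', v *\<^sub>R I)) has_derivative (\<lambda>w. h' (w, 0))) (at u)"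
    by (rule has_derivative_compose[of "\<lambda>u'. (u', v *\<^sub>R I)"])
      (auto intro!: derivative_eq_intros h')
  then have 1: "vector_derivative (\<lambda>u'. h (u', v *\<^sub>R I)) (at u) = h' (1, 0)"
    by (intro vector_derivative_at)
      (simp add: has_vector_derivative_def h'.scaleR[symmetric])
  have "((\<lambda>v'. h (u, v' *\<^sub>R I)) has_derivative (\<lambda>w. h' (0, w *\<^sub>R I))) (at v)"
    by (rule has_derivative_compose[of "\<lambda>v'. (u, v' *\<^sub>R I)"])
      (auto intro!: derivative_eq_intros h')
  then have 2: "vector_derivative (\<lambda>v'. h (u, v' *\<^sub>R I)) (at v) = h' (0, I)"
    by (intro vector_derivative_at)
      (simp add: has_vector_derivative_def h'.scaleR[symmetric])
  show ?thesis
    using assms(1-3) unfolding slice_monogenic_def 1[symmetric] 2[symmetric] by blast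
qed

text \<open>Since \<open>I\<close> squares to -1, multiplying the slice equation by \<open>I\<close>
  gives \<open>I * h' (1, 0) = h' (0, I)\<close>. Both sides are linear in \<open>I\<close>, so
  scaling by \<open>v\<close> yields a form that no longer mentions the slice.\<close>

lemma slice_monogenic_radial:
  assumes "h \<in> slice_monogenic W" "(u, y) \<in> W" and h': "(h has_derivative h') (at (u, y))"
  shows "vec_to_clifford y * h' (1, 0) = h' (0, y)"
proof -
  interpret h': bounded_linear h' using h' by (rule has_derivative_bounded_linear)
  obtain I v where I: "I \<in> \<S>" and y: "y = v *\<^sub>R I" by (rule scaled_unit_vector)
  have "h' (1, 0) = - (vec_to_clifford I * h' (0, I))"
    using slice_monogenic_derivative[of h W I u v h'] assms I y
    by (simp add: eq_neg_iff_add_eq_0)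
  then have "vec_to_clifford I * h' (1, 0) = h' (0, I)"
    using vec_to_clifford_unit[OF I] by (simp add: mult.assoc[symmetric])
  then show ?thesis
    using h'.scaleR[of v "(0, I)"] by (simp add: y vec_to_clifford_scaleR)
qed

text \<open>By the chain rule, the radial identity at \<open>(u, a x)\<close> equates the first term
  of the operator with \<open>f' (0, g' (a x))\<close>; the double sum is the same vector expanded
  in coordinates.\<close>

lemma H_op_eq_0:
  assumes W: "(u, a x) \<in> W" "x \<in> U" "inj_on a U"
    and f: "(f has_derivative f') (at (u, x))"
    and g: "(inv_into U a has_derivative g') (at (a x))"
    and h: "f \<circ> map_prod id (inv_into U a) \<in> slice_monogenic W"
  shows "H_op U a f (u, x) = 0"
proof -
  interpret f': bounded_linear f' using f by (rule has_derivative_bounded_linear)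
  interpret g': bounded_linear g' using g by (rule has_derivative_bounded_linear)
  let ?g = "inv_into U a"
  have ga: "?g (a x) = x" using W by simp
  have "((\<lambda>p. (fst p, ?g (snd p))) has_derivative (\<lambda>p. (fst p, g' (snd p)))) (at (u, a x))"
    by (auto intro!: derivative_eq_intros has_derivative_compose[of snd _ _ _ ?g] g)
  then have "((\<lambda>p. f (fst p, ?g (snd p))) has_derivative (\<lambda>p. f' (fst p, g' (snd p))))
      (at (u, a x))"
    by (rule has_derivative_compose) (simp add: ga f)
  then have "((f \<circ> map_prod id ?g) has_derivative (\<lambda>p. f' (fst p, g' (snd p)))) (at (u, a x))"
    by (simp add: o_def map_prod_def split_beta)
  from slice_monogenic_radial[OF h W(1) this]
  have radial: "vec_to_clifford (a x) * f' (1, 0) = f' (0, g' (a x))"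
    by (simp add: g'.zero)
  have "((\<lambda>y. ?g y $ i) has_derivative (\<lambda>w. g' w $ i)) (at (a x))" for i
    using g by (rule bounded_linear.has_derivative[OF bounded_linear_vec_nth])
  then have dg: "partial (axis j 1) (\<lambda>y. ?g y $ i) (a x) = g' (axis j 1) $ i" for i j
    by (rule partial_eq)
  \<comment> \<open>This is the inner sum of the operator, obtained by expanding \<open>a x\<close>
    in the standard basis; expanding \<open>g' (a x)\<close> next gives the outer sum.\<close>
  have "g' (a x) $ i = (\<Sum>j\<in>UNIV. a x $ j * g' (axis j 1) $ i)" for i
    by (subst basis_expansion[of "a x", symmetric])
      (simp only: g'.sum g'.scaleR sum_component vector_scaleR_component scalar_mult_eq_scaleR
        real_scaleR_def)
  moreover have "f' (0, g' (a x)) = (\<Sum>i\<in>UNIV. (g' (a x) $ i) *\<^sub>R f' (0, axis i 1))"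
  proof -
    let ?w = "g' (a x)"
    have "(0, ?w) = (\<Sum>i\<in>UNIV. (?w $ i) *\<^sub>R (0, axis i 1))"
      using basis_expansion[of ?w]
      by (simp add: prod_eq_iff fst_sum snd_sum scalar_mult_eq_scaleR)
    from arg_cong[OF this, of f'] show ?thesis by (simp only: f'.sum f'.scaleR)
  qed
  ultimately show ?thesis
    by (simp add: H_op_def partial_eq[OF f] dg radial)
qed


section \<open>Coordinates with respect to a system of generators\<close>

text \<open>Indexing by the subset instead of the basis element is faithful once
  \<open>ordered_prod b\<close> is injective; \<open>representation\<close> returns 0 outside the
  span or for a dependent family.\<close>

definition coordinate ::
  "('n::{finite,linorder} \<Rightarrow> 'n clifford) \<Rightarrow> 'n set \<Rightarrow> 'n clifford \<Rightarrow> real" where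
  "coordinate b A x = representation (range (ordered_prod b)) x (ordered_prod b A)"

lemma clifford_generatorsD:
  assumes "clifford_generators b"
  shows "inj (ordered_prod b)" "independent (range (ordered_prod b))"
    "x \<in> span (range (ordered_prod b))" "b r * b r = -1"
proof -
  have "b r * b r + b r * b r = -2"
    using assms unfolding clifford_generators_def by presburger
  then have "2 *\<^sub>R (b r * b r) = 2 *\<^sub>R (- 1)" by (simp add: scaleR_2)
  then show "b r * b r = -1" by (simp only: scaleR_cancel_left) simp
qed (use assms in \<open>simp_all add: clifford_generators_def\<close>)

lemma linear_coordinate:
  assumes "clifford_generators b"
  shows "linear (coordinate b A)"
  unfolding coordinate_def
  by (rule linearI)
    (simp_all add: clifford_generatorsD[OF assms] real_vector.representation_add
      real_vector.representation_scale)

lemma coordinate_basis: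
  assumes "clifford_generators b"
  shows "coordinate b A (ordered_prod b B) = (if A = B then 1 else 0)"
  unfolding coordinate_def
  using real_vector.representation_basis[OF clifford_generatorsD(2)[OF assms], of "ordered_prod b B"]
  by (simp add: inj_eq[OF clifford_generatorsD(1)[OF assms]] eq_commute)

lemma sum_coordinates:
  assumes "clifford_generators b"
  shows "(\<Sum>A\<in>UNIV. coordinate b A x *\<^sub>R ordered_prod b A) = x"
proof -
  have "(\<Sum>e\<in>range (ordered_prod b). representation (range (ordered_prod b)) x e *\<^sub>R e) = x"
    by (rule real_vector.sum_representation_eq) (simp_all add: clifford_generatorsD[OF assms])
  then show ?thesis
    by (simp add: clifford_generatorsD(1)[OF assms] coordinate_def sum.reindex)
qed

text \<open>The least index heads the sorted list, so no reordering and no sign occur.\<close>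

lemma ordered_prod_insert_Min:
  assumes "Min UNIV \<notin> A"
  shows "ordered_prod b (insert (Min UNIV) A) = b (Min UNIV) * ordered_prod b A"
proof -
  have "Min (insert (Min UNIV) A) = Min UNIV"
    by (rule Min_eqI) auto
  then have "sorted_list_of_set (insert (Min UNIV) A) = Min UNIV # sorted_list_of_set A"
    using assms sorted_list_of_set_nonempty[of "insert (Min UNIV) A"] by simp
  then show ?thesis by (simp add: ordered_prod_def)
qed

text \<open>The coordinates at \<open>A\<close> and \<open>insert (Min UNIV) A\<close> form a pair
  on which left multiplication by \<open>b (Min UNIV)\<close> acts as multiplication by i acts on
  real and imaginary parts. By linearity it suffices to check basis elements.\<close>

lemma coordinate_mult_Min:
  assumes b: "clifford_generators b" and A: "Min UNIV \<notin> A"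
  shows "coordinate b A (b (Min UNIV) * x) = - coordinate b (insert (Min UNIV) A) x"
    and "coordinate b (insert (Min UNIV) A) (b (Min UNIV) * x) = coordinate b A x"
proof -
  let ?m = "Min UNIV"
  note sq = clifford_generatorsD(4)[OF b, of ?m] and in_span = clifford_generatorsD(3)[OF b]
  have lin: "linear (coordinate b B)" for B by (rule linear_coordinate[OF b])
  have lm: "linear (\<lambda>x. coordinate b B (b ?m * x))" for B
    by (rule linearI) (simp_all add: distrib_left linear_add[OF lin] linear_scale[OF lin])
  have on_basis: "coordinate b A (b ?m * ordered_prod b B) =
        - coordinate b (insert ?m A) (ordered_prod b B) \<and>
      coordinate b (insert ?m A) (b ?m * ordered_prod b B) = coordinate b A (ordered_prod b B)"
    for B
  proof (cases "?m \<in> B")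
    case True
    then obtain C where C: "B = insert ?m C" "?m \<notin> C" by (meson mk_disjoint_insert)
    have "insert ?m A \<noteq> C" "A \<noteq> insert ?m C" "insert ?m A = insert ?m C \<longleftrightarrow> A = C"
      using A C(2) by (blast, blast, simp add: insert_ident)
    \<comment> \<open>The leading factor of the product is \<open>b ?m\<close>, whose square -1
      removes the index and leaves the sign.\<close>
    moreover have "b ?m * ordered_prod b B = - ordered_prod b C"
      using C by (simp add: ordered_prod_insert_Min mult.assoc[symmetric] sq)
    ultimately show ?thesis
      by (simp add: C(1) linear_neg[OF lin] coordinate_basis[OF b])
  next
    case False
    have "insert ?m A \<noteq> B" "A \<noteq> insert ?m B" "insert ?m A = insert ?m B \<longleftrightarrow> A = B"
      using A False by (blast, blast, simp add: insert_ident)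
    then show ?thesis
      using False by (simp add: ordered_prod_insert_Min[symmetric] coordinate_basis[OF b])
  qed
  show "coordinate b A (b ?m * x) = - coordinate b (insert ?m A) x"
  proof (rule linear_eq_on_span[of "\<lambda>x. coordinate b A (b ?m * x)"
        "\<lambda>x. - coordinate b (insert ?m A) x", OF lm linear_compose_neg[OF lin] _ in_span])
    show "coordinate b A (b ?m * e) = - coordinate b (insert ?m A) e"
      if "e \<in> range (ordered_prod b)" for e
      using that on_basis by auto
  qed
  show "coordinate b (insert ?m A) (b ?m * x) = coordinate b A x"
  proof (rule linear_eq_on_span[of "\<lambda>x. coordinate b (insert ?m A) (b ?m * x)"
        "coordinate b A", OF lm lin _ in_span])
    show "coordinate b (insert ?m A) (b ?m * e) = coordinate b A e"
      if "e \<in> range (ordered_prod b)" for e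
      using that on_basis by auto
  qed
qed

text \<open>Each subset without the least index is paired with the subset obtained by inserting it;
  the two terms share the right factor \<open>ordered_prod b A\<close>.\<close>

lemma sum_coordinates_split:
  assumes b: "clifford_generators b"
  shows "(\<Sum>A\<in>Pow (UNIV - {Min UNIV}).
    (of_real (coordinate b A x) + coordinate b (insert (Min UNIV) A) x *\<^sub>R b (Min UNIV)) *
      ordered_prod b A) = x"
proof -
  let ?m = "Min UNIV"
  let ?P = "Pow (UNIV - {?m})"
  let ?c = "\<lambda>A. coordinate b A x *\<^sub>R ordered_prod b A"
  have P: "?P \<union> insert ?m ` ?P = UNIV"
    by (simp only: Pow_insert[symmetric] insert_Diff[OF UNIV_I] Pow_UNIV)
  have "x = (\<Sum>A\<in>?P \<union> insert ?m ` ?P. ?c A)"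
    unfolding P by (rule sum_coordinates[OF b, symmetric])
  also have "\<dots> = (\<Sum>A\<in>?P. ?c A) + (\<Sum>A\<in>insert ?m ` ?P. ?c A)"
    by (rule sum.union_disjoint) auto
  also have "(\<Sum>A\<in>insert ?m ` ?P. ?c A) = (\<Sum>A\<in>?P. ?c (insert ?m A))"
    by (subst sum.reindex) (auto intro!: inj_onI simp: insert_ident subset_Diff_insert)
  also have "(\<Sum>A\<in>?P. ?c A) + (\<Sum>A\<in>?P. ?c (insert ?m A)) =
      (\<Sum>A\<in>?P. (of_real (coordinate b A x) + coordinate b (insert ?m A) x *\<^sub>R b ?m) *
        ordered_prod b A)"
    unfolding sum.distrib[symmetric]
    by (rule sum.cong)
      (auto simp: ordered_prod_insert_Min[symmetric] distrib_right of_real_def subset_Diff_insert)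
  finally show ?thesis by simp
qed


section \<open>Splitting into holomorphic components\<close>

lemma inj_slice_iso: "I \<in> \<S> \<Longrightarrow> inj (slice_iso I)"
  by (rule injI) (auto simp: slice_iso_def unit_vectors_def complex_eq_iff)

lemma paravector_slice_iso:
  "paravector (slice_iso I z) = of_real (Re z) + Im z *\<^sub>R vec_to_clifford I"
  by (simp add: paravector_def slice_iso_def vec_to_clifford_scaleR)

text \<open>Reads the coordinate pair as a complex number, so that left multiplication by the first
  generator becomes multiplication by i.\<close>

definition slice_component ::
  "('n::{finite,linorder} \<Rightarrow> 'n clifford) \<Rightarrow> 'n set \<Rightarrow> 'n clifford \<Rightarrow> complex" where
  "slice_component b A x = Complex (coordinate b A x) (coordinate b (insert (Min UNIV) A) x)"

lemma slice_component_holomorphic: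
  fixes h :: "'n::{finite,linorder} point \<Rightarrow> 'n clifford"
  assumes b: "clifford_generators b" and A: "Min UNIV \<notin> A"
    and I: "I \<in> \<S>" "b (Min UNIV) = vec_to_clifford I"
    and h: "h \<in> slice_monogenic W" and W: "open W"
  shows "(\<lambda>z. slice_component b A (h (slice_iso I z))) holomorphic_on (slice_iso I -` W)"
  unfolding holomorphic_on_def
proof
  let ?\<alpha> = "coordinate b A"
  let ?\<beta> = "coordinate b (insert (Min UNIV) A)"
  fix z assume z: "z \<in> slice_iso I -` W"
  then have zW: "(Re z, Im z *\<^sub>R I) \<in> W" by (simp add: slice_iso_def)
  have "h differentiable (at (Re z, Im z *\<^sub>R I))"
    using h W zW by (simp add: slice_monogenic_def differentiable_on_eq_differentiable_at)
  then obtain h' where h': "(h has_derivative h') (at (Re z, Im z *\<^sub>R I))"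
    by (auto simp: differentiable_def)
  interpret h': bounded_linear h' using h' by (rule has_derivative_bounded_linear)
  have bl: "bounded_linear (coordinate b B)" for B
    using linear_coordinate[OF b] by (simp add: linear_conv_bounded_linear)
  interpret \<alpha>: bounded_linear ?\<alpha> by (rule bl)
  interpret \<beta>: bounded_linear ?\<beta> by (rule bl)
  define p q where "p = h' (1, 0)" and "q = h' (0, I)"
  have h'_eq: "h' (x, y *\<^sub>R I) = x *\<^sub>R p + y *\<^sub>R q" for x y
    using h'.add[of "(x, 0)" "(0, y *\<^sub>R I)"] h'.scaleR[of x "(1, 0)"] h'.scaleR[of y "(0, I)"]
    by (simp add: p_def q_def)
  have "p = - (b (Min UNIV) * q)"
    using slice_monogenic_derivative[OF h I(1) zW h']
    by (simp add: p_def q_def I(2) eq_neg_iff_add_eq_0)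
  \<comment> \<open>These are the Cauchy-Riemann equations for the pair: \<open>p\<close> and
    \<open>q\<close> are the derivatives of \<open>h\<close> in the real and imaginary directions of
    the slice.\<close>
  then have CR: "?\<alpha> p = ?\<beta> q" "?\<beta> p = - ?\<alpha> q"
    by (simp_all add: \<alpha>.neg \<beta>.neg coordinate_mult_Min[OF b A])
  have "((\<lambda>z. h (Re z, Im z *\<^sub>R I)) has_derivative (\<lambda>w. h' (Re w, Im w *\<^sub>R I))) (at z)"
    by (rule has_derivative_compose[of "\<lambda>z. (Re z, Im z *\<^sub>R I)"])
      (auto intro!: derivative_eq_intros h')
  then have "((\<lambda>z. coordinate b B (h (Re z, Im z *\<^sub>R I))) has_derivative
      (\<lambda>w. coordinate b B (h' (Re w, Im w *\<^sub>R I)))) (at z)" for B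
    by (rule bounded_linear.has_derivative[OF bl])
  note D = this
  have "((\<lambda>z. of_real (?\<alpha> (h (Re z, Im z *\<^sub>R I))) + \<i> * of_real (?\<beta> (h (Re z, Im z *\<^sub>R I))))
      has_derivative (\<lambda>w. of_real (?\<alpha> (h' (Re w, Im w *\<^sub>R I))) +
        \<i> * of_real (?\<beta> (h' (Re w, Im w *\<^sub>R I))))) (at z)"
    by (intro has_derivative_add has_derivative_mult_right
        bounded_linear.has_derivative[OF bounded_linear_of_real] D)
  \<comment> \<open>By \<open>CR\<close> the coordinates of \<open>q\<close> are those of i times
    the complex number given by \<open>p\<close>, so the real derivative is complex linear.\<close>
  moreover have "(\<lambda>w. of_real (?\<alpha> (h' (Re w, Im w *\<^sub>R I))) +
        \<i> * of_real (?\<beta> (h' (Re w, Im w *\<^sub>R I)))) = (*) (Complex (?\<alpha> p) (?\<beta> p))"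
    by (rule ext) (simp add: complex_eq_iff h'_eq \<alpha>.add \<beta>.add \<alpha>.scaleR \<beta>.scaleR CR)
  ultimately have "((\<lambda>z. slice_component b A (h (slice_iso I z))) has_field_derivative
      Complex (?\<alpha> p) (?\<beta> p)) (at z)"
    by (simp add: has_field_derivative_def slice_component_def slice_iso_def Complex_eq)
  then show "(\<lambda>z. slice_component b A (h (slice_iso I z))) field_differentiable
      (at z within slice_iso I -` W)"
    by (meson field_differentiable_def has_field_derivative_at_within)
qed

theorem lemma3p10:
  fixes U V :: "(real, 'n::{finite,linorder}) vec set"
    and s t :: ereal
    and a :: "(real, 'n) vec \<Rightarrow> (real, 'n) vec"
    and f :: "'n point \<Rightarrow> 'n clifford"
  assumes "domain_in UNIV U" and "domain_in UNIV V"
    and "s < t"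
    and "C1_diffeomorphism U V a"
    and "s_domain (einterval s t \<times> V)"
    and "axially_symmetric (einterval s t \<times> V)"
    and "C1_on (einterval s t \<times> U) f"
    and "f \<circ> map_prod id (inv_into U a) \<in> slice_monogenic (einterval s t \<times> V)"
  shows "(\<forall>x \<in> einterval s t \<times> U. H_op U a f x = 0) \<and>
    (\<forall>I\<in>\<S>. \<forall>b :: 'n \<Rightarrow> 'n clifford.
      b (Min UNIV) = vec_to_clifford I \<and> clifford_generators b \<longrightarrow>
      (\<exists>F :: 'n set \<Rightarrow> 'n point \<Rightarrow> 'n point.
        (\<forall>A \<subseteq> UNIV - {Min UNIV}.
          holomorphic_slice_on I (F A) ((einterval s t \<times> V) \<inter> slice I)) \<and>
        (\<forall>x \<in> einterval s t \<times> U.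
          map_prod id a x \<in> (einterval s t \<times> V) \<inter> slice I \<longrightarrow>
          f x = (\<Sum>A \<in> Pow (UNIV - {Min UNIV}).
            paravector (F A (map_prod id a x)) * ordered_prod b A))))"
proof (intro conjI ballI allI impI)
  let ?W = "einterval s t \<times> V"
  let ?h = "f \<circ> map_prod id (inv_into U a)"
  have inj: "inj_on a U" and aU: "a ` U = V"
    using assms(4) by (auto simp: C1_diffeomorphism_def bij_betw_def)
  have W: "open ?W"
    using assms(5) by (simp add: s_domain_def domain_in_def)
  show "H_op U a f x = 0" if xU: "x \<in> einterval s t \<times> U" for x
  proof -
    obtain u y where x: "x = (u, y)" "u \<in> einterval s t" "y \<in> U" using xU by auto
    obtain f' where "(f has_derivative f') (at (u, y))"
      using assms(7) xU unfolding C1_on_def x(1) by blast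
    moreover obtain g' where "(inv_into U a has_derivative g') (at (a y))"
      using assms(4) x(3) aU unfolding C1_diffeomorphism_def C1_on_def by blast
    ultimately show ?thesis
      unfolding x(1) using x aU by (intro H_op_eq_0[OF _ _ inj _ _ assms(8)]) auto
  qed
  fix I :: "(real, 'n) vec" and b :: "'n \<Rightarrow> 'n clifford"
  assume I: "I \<in> \<S>" and "b (Min UNIV) = vec_to_clifford I \<and> clifford_generators b"
  then have bI: "b (Min UNIV) = vec_to_clifford I" and b: "clifford_generators b" by auto
  \<comment> \<open>The component of \<open>?h\<close> at \<open>A\<close>, carried from the complex
    plane back into the slice of \<open>I\<close>.\<close>
  define F where "F A p = slice_iso I (slice_component b A (?h p))" for A p
  have "holomorphic_slice_on I (F A) (?W \<inter> slice I)" if "A \<subseteq> UNIV - {Min UNIV}" for A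
  proof -
    have "inv (slice_iso I) \<circ> F A \<circ> slice_iso I =
        (\<lambda>z. slice_component b A (?h (slice_iso I z)))"
      by (rule ext) (simp add: F_def inv_f_f[OF inj_slice_iso[OF I]])
    moreover have "slice_iso I -` (?W \<inter> slice I) = slice_iso I -` ?W"
      by (auto simp: slice_def)
    moreover have "Min UNIV \<notin> A" using that by blast
    moreover have "F A ` (?W \<inter> slice I) \<subseteq> slice I"
      by (auto simp: F_def slice_def)
    ultimately show ?thesis
      using slice_component_holomorphic[OF b _ I bI assms(8) W, of A]
      unfolding holomorphic_slice_on_def by auto
  qed
  \<comment> \<open>Because \<open>?h\<close> takes the value \<open>f x\<close> at the image of
    \<open>x\<close>, this is the paired coordinate expansion of \<open>f x\<close>, with the first
    generator written as the vector \<open>I\<close>.\<close>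
  moreover have "f x = (\<Sum>A \<in> Pow (UNIV - {Min UNIV}).
      paravector (F A (map_prod id a x)) * ordered_prod b A)" if "x \<in> einterval s t \<times> U" for x
  proof -
    have "?h (map_prod id a x) = f x" using that inj by auto
    then show ?thesis
      using sum_coordinates_split[OF b, of "f x"]
      unfolding F_def paravector_slice_iso by (simp add: slice_component_def bI)
  qed
  ultimately show "\<exists>F. (\<forall>A \<subseteq> UNIV - {Min UNIV}. holomorphic_slice_on I (F A) (?W \<inter> slice I)) \<and>
      (\<forall>x \<in> einterval s t \<times> U. map_prod id a x \<in> ?W \<inter> slice I \<longrightarrow>
        f x = (\<Sum>A \<in> Pow (UNIV - {Min UNIV}).
          paravector (F A (map_prod id a x)) * ordered_prod b A))"
    by blast
qed

end
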